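(* Let $S$ be a semigroup and let $a,b\in S$ be group elements. Then: (1) $a\sim_p b$ if and only if there exist mutually inverse elements $u,v\in S$ such that $b=uav$ and $a=vbu$; (2) $a\sim b$ if and only if $a\sim_p b$.
   Context: Let $S$ be a semigroup. An element $a\in S$ is a group element if it belongs to some subgroup of $S$ (a subsemigroup which is a group under the operation of $S$, with its own identity element). Elements $u,v\in S$ are mutually inverse if $u=uvu$ and $v=vuv$. Write $a\sim_p b$ (primary conjugacy) if there exist $x,y\in S$ with $a=xy$ and $b=yx$. The relation $\sim$ (conjugacy) is the transitive closure of $\sim_p$ on $S$. *)

theory Defs
  imports Main
begin

text \<open>The ambient semigroup is the carrier of a type of class \<^class>\<open>semigroup_mult\<close>.\<close>

definition is_subgroup :: "'a::semigroup_mult set \<Rightarrow> bool" where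
  "is_subgroup G \<longleftrightarrow>
     (\<forall>x\<in>G. \<forall>y\<in>G. x * y \<in> G) \<and>
     (\<exists>e\<in>G. (\<forall>x\<in>G. e * x = x \<and> x * e = x) \<and>
             (\<forall>x\<in>G. \<exists>y\<in>G. x * y = e \<and> y * x = e))"

definition group_element :: "'a::semigroup_mult \<Rightarrow> bool" where
  "group_element a \<longleftrightarrow> (\<exists>G. is_subgroup G \<and> a \<in> G)"

definition mutually_inverse :: "'a::semigroup_mult \<Rightarrow> 'a \<Rightarrow> bool" where
  "mutually_inverse u v \<longleftrightarrow> u = u * v * u \<and> v = v * u * v"

text \<open>The factors range over the semigroup itself, with no identity adjoined, so this
  relation need not be reflexive on arbitrary elements.\<close>

definition primary_conjugate :: "'a::semigroup_mult \<Rightarrow> 'a \<Rightarrow> bool"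
    (infix \<open>\<sim>\<^sub>p\<close> 50) where
  "a \<sim>\<^sub>p b \<longleftrightarrow> (\<exists>x y. a = x * y \<and> b = y * x)"

text \<open>Intermediate elements of a chain are arbitrary; they need not be group elements.\<close>

definition conjugate :: "'a::semigroup_mult \<Rightarrow> 'a \<Rightarrow> bool"
    (infix \<open>\<sim>\<close> 50) where
  "a \<sim> b \<longleftrightarrow> primary_conjugate\<^sup>+\<^sup>+ a b"

end

theory Submission
  imports Defs
begin

text \<open>
  Write \<open>h\<close> for the inverse of a group element \<open>a\<close> in its subgroup, so that \<open>a * h\<close> is the
  identity of that subgroup.  If \<open>a = x * y\<close> and \<open>b = y * x\<close>, then \<open>y\<close> intertwines \<open>a\<close> and \<open>b\<close>
  (\<open>y * a = b * y\<close>), hence it also intertwines their identities.  Cutting \<open>y\<close> down to the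
  identity and correcting \<open>x\<close> by \<open>h\<close> turns the two factors into mutually inverse
  elements \<open>u = y * a * h\<close> and \<open>v = h * x\<close> that conjugate \<open>a\<close> into \<open>b\<close>.  Conversely, mutually
  inverse conjugators give the factorisation \<open>a = v * (b * u)\<close>.  Since conjugators can be
  multiplied, primary conjugacy through a group element is transitive between group elements.

  In a chain of primary conjugacies between two group elements, the intermediate elements need not
  be group elements, so transitivity does not apply directly.  Each of them does,
  however, have a Drazin inverse: Cline's formula says that if \<open>h\<close> is the Drazin inverse of \<open>x * y\<close>,
  then \<open>y * h * h * x\<close> is the Drazin inverse of \<open>y * x\<close>.  An element \<open>c\<close> with Drazin inverse \<open>h\<close> can
  be replaced by its core \<open>c * c * h\<close>, which is a group element; the cores of
  neighbours in the chain are again primarily conjugate, and a group element is its own core.  So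
  the chain of cores joins the same two end points and consists of group elements, and
  transitivity collapses it to a single step.  All this works for a power-free weakening
  of the notion of Drazin inverse, which is the one used below.
\<close>

section \<open>Group elements and their conjugators\<close>

definition group_inverse :: "'a::semigroup_mult \<Rightarrow> 'a \<Rightarrow> bool" where
  "group_inverse a h \<longleftrightarrow> a * h = h * a \<and> a * h * a = a \<and> h * a * h = h"

text \<open>Together with associativity these rules bring every product to a form in which each block of
  factors \<open>a\<close> and \<open>h\<close> is a power of \<open>a\<close>, a power of \<open>h\<close>, or the identity \<open>a * h\<close>.\<close>

lemma group_inverse_rewrites:
  assumes "group_inverse a h"
  shows "h * a = a * h" and "h * (a * z) = a * (h * z)"
    and "a * (a * h) = a" and "a * (a * (h * z)) = a * z"
    and "a * (h * h) = h" and "a * (h * (h * z)) = h * z"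
proof -
  from assms have ha: "h * a = a * h" and "a * h * a = a" "h * a * h = h"
    by (auto simp: group_inverse_def)
  then have aah: "a * (a * h) = a" and ahh: "a * h * h = h"
    by (metis mult.assoc)+
  show "h * a = a * h" "a * (a * h) = a"
    by fact+
  show "a * (h * h) = h"
    using ahh by (simp add: mult.assoc)
  show "h * (a * z) = a * (h * z)"
    using ha by (simp flip: mult.assoc)
  show "a * (a * (h * z)) = a * z"
    using aah by (simp flip: mult.assoc)
  show "a * (h * (h * z)) = h * z"
    using ahh by (simp flip: mult.assoc)
qed

lemma group_element_has_group_inverse:
  assumes "group_element a"
  obtains h where "group_inverse a h"
proof -
  from assms obtain G where G: "is_subgroup G" "a \<in> G"
    by (auto simp: group_element_def)
  then obtain e where e: "\<forall>x\<in>G. e * x = x \<and> x * e = x" "\<forall>x\<in>G. \<exists>y\<in>G. x * y = e \<and> y * x = e"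
    by (auto simp: is_subgroup_def)
  with G obtain h where "h \<in> G" "a * h = e" "h * a = e"
    by blast
  with e G have "group_inverse a h"
    by (simp add: group_inverse_def)
  then show thesis
    by (rule that)
qed

text \<open>From \<open>y * a = b * y\<close> and \<open>b = k * b * b\<close> one gets \<open>y * a * h = k * y * a * a * h\<close>, which is
  \<open>k * y * a = k * b * y\<close>.\<close>

lemma intertwines_identities:
  assumes h: "group_inverse a h" and k: "group_inverse b k" and ya: "y * a = b * y"
  shows "y * a * h = b * k * y"
proof -
  have "y * a * h = k * b * b * y * h"
    by (simp add: ya mult.assoc group_inverse_rewrites[OF k])
  also have "\<dots> = k * (b * (b * y)) * h"
    by (simp add: mult.assoc)
  also have "b * (b * y) = y * a * a"
    by (simp add: ya flip: mult.assoc) (simp add: ya mult.assoc)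
  also have "k * (y * a * a) * h = k * (y * a)"
    by (simp add: mult.assoc group_inverse_rewrites[OF h])
  also have "\<dots> = b * k * y"
    by (simp add: ya mult.assoc group_inverse_rewrites[OF k])
  finally show ?thesis .
qed

lemma primary_conjugate_imp_conjugators:
  assumes h: "group_inverse a h" and k: "group_inverse b k" and "a \<sim>\<^sub>p b"
  obtains u v where "mutually_inverse u v" and "b = u * a * v" and "a = v * b * u"
proof -
  from \<open>a \<sim>\<^sub>p b\<close> obtain x y where a: "a = x * y" and b: "b = y * x"
    by (auto simp: primary_conjugate_def)
  note a_simps = mult.assoc group_inverse_rewrites[OF h]
  have "y * a = b * y"
    by (simp add: a b mult.assoc)
  then have yh: "y * a * h = b * k * y"
    by (rule intertwines_identities[OF h k])
  define u v where "u = y * a * h" and "v = h * x"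
  have vu: "v * u = a * h"
  proof -
    have "v * u = h * (x * y) * a * h"
      by (simp add: u_def v_def mult.assoc)
    also have "\<dots> = a * h"
      unfolding a[symmetric] by (simp add: a_simps)
    finally show ?thesis .
  qed
  have "u * (v * u) = u"
    unfolding vu by (simp add: u_def a_simps)
  moreover have "v * u * v = v"
    unfolding vu by (simp add: v_def a_simps)
  ultimately have "mutually_inverse u v"
    by (simp add: mutually_inverse_def mult.assoc)
  moreover have "b = u * a * v"
  proof -
    have "u * a * v = y * a * h * x"
      by (simp add: u_def v_def a_simps)
    also have "\<dots> = b * k * (y * x)"
      unfolding yh by (simp add: mult.assoc)
    also have "\<dots> = b"
      unfolding b[symmetric] by (simp add: mult.assoc group_inverse_rewrites[OF k])
    finally show ?thesis by simp
  qed
  moreover have "a = v * b * u"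
  proof -
    have "v * b * u = h * (x * y) * (x * y) * a * h"
      by (simp add: u_def v_def b mult.assoc)
    also have "\<dots> = a"
      unfolding a[symmetric] by (simp add: a_simps)
    finally show ?thesis by simp
  qed
  ultimately show thesis
    by (rule that)
qed

lemma conjugators_absorbed:
  assumes "mutually_inverse u v" and "b = u * a * v"
  shows "b * u * v = b"
proof -
  have vuv: "v * u * v = v"
    using assms(1) unfolding mutually_inverse_def by (rule conjunct2[THEN sym])
  have "b * u * v = u * a * (v * u * v)"
    by (simp add: assms(2) mult.assoc)
  also have "\<dots> = b"
    by (simp add: vuv assms(2))
  finally show ?thesis .
qed

lemma conjugators_imp_primary_conjugate:
  assumes "mutually_inverse u v" and "b = u * a * v" and "a = v * b * u"
  shows "a \<sim>\<^sub>p b"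
proof -
  have "a = v * (b * u)"
    using assms(3) by (simp add: mult.assoc)
  moreover have "b = (b * u) * v"
    using conjugators_absorbed[OF assms(1,2)] by simp
  ultimately show ?thesis
    unfolding primary_conjugate_def by (intro exI conjI)
qed

text \<open>The products \<open>u2 * u1\<close> and \<open>v1 * v2\<close> conjugate \<open>a\<close> into \<open>c\<close>.  They need not be mutually
  inverse, but the middle element \<open>b\<close> absorbs both \<open>u1 * v1\<close> and \<open>v2 * u2\<close>, which is
  enough for \<open>c\<close> to absorb \<open>u2 * u1 * v1 * v2\<close>.\<close>

lemma primary_conjugate_trans:
  assumes inv: "group_inverse a h" "group_inverse b k" "group_inverse c l"
    and ab: "a \<sim>\<^sub>p b" and bc: "b \<sim>\<^sub>p c"
  shows "a \<sim>\<^sub>p c"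
proof -
  obtain u1 v1 where 1: "mutually_inverse u1 v1" "b = u1 * a * v1" "a = v1 * b * u1"
    using primary_conjugate_imp_conjugators[OF inv(1,2) ab] .
  obtain u2 v2 where 2: "mutually_inverse u2 v2" "c = u2 * b * v2" "b = v2 * c * u2"
    using primary_conjugate_imp_conjugators[OF inv(2,3) bc] .
  have absorb1: "b * u1 * v1 = b"
    using conjugators_absorbed[OF 1(1,2)] .
  have "mutually_inverse v2 u2"
    using 2(1) unfolding mutually_inverse_def by (rule conj_commute[THEN iffD1])
  then have absorb2: "b * v2 * u2 = b"
    using 2(3) by (rule conjugators_absorbed)
  have "a = (v1 * v2) * (c * u2 * u1)"
    by (subst 1(3), subst 2(3)) (simp add: mult.assoc)
  moreover have "c = (c * u2 * u1) * (v1 * v2)"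
  proof -
    have "(c * u2 * u1) * (v1 * v2) = u2 * (b * v2 * u2) * u1 * v1 * v2"
      by (simp add: 2(2) mult.assoc)
    also have "\<dots> = u2 * (b * u1 * v1) * v2"
      unfolding absorb2 by (simp add: mult.assoc)
    also have "\<dots> = c"
      using absorb1 2(2) by simp
    finally show ?thesis by simp
  qed
  ultimately show ?thesis
    unfolding primary_conjugate_def by (intro exI conjI)
qed

section \<open>Drazin inverses and cores\<close>

definition commuting_outer_inverse :: "'a::semigroup_mult \<Rightarrow> 'a \<Rightarrow> bool" where
  "commuting_outer_inverse c k \<longleftrightarrow> c * k = k * c \<and> k * c * k = k"

lemma commuting_outer_inverse_rewrites:
  assumes "commuting_outer_inverse c h"
  shows "h * c = c * h" and "h * (c * z) = c * (h * z)"
    and "c * (h * h) = h" and "c * (h * (h * z)) = h * z"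
proof -
  from assms have hc: "h * c = c * h" and chh: "c * h * h = h"
    by (auto simp: commuting_outer_inverse_def)
  show "h * c = c * h"
    by fact
  show "c * (h * h) = h"
    using chh by (simp add: mult.assoc)
  show "h * (c * z) = c * (h * z)"
    using hc by (simp flip: mult.assoc)
  show "c * (h * (h * z)) = h * z"
    using chh by (simp flip: mult.assoc)
qed

text \<open>The usual definition of the Drazin inverse asks for \<open>c\<^sup>n\<^sup>+\<^sup>1 * h = c\<^sup>n\<close> for some
  \<open>n\<close>.  Here this is weakened to a condition free of powers: the idempotent \<open>c * h\<close> is a right
  identity for all commuting outer inverses.  The usual condition implies it,
  as \<open>k = k\<^sup>n\<^sup>+\<^sup>1 * c\<^sup>n\<close> for every commuting outer inverse \<open>k\<close>.\<close>

definition weak_drazin_inverse :: "'a::semigroup_mult \<Rightarrow> 'a \<Rightarrow> bool" where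
  "weak_drazin_inverse c h \<longleftrightarrow> commuting_outer_inverse c h \<and>
     (\<forall>k. commuting_outer_inverse c k \<longrightarrow> k * c * h = k)"

lemma group_inverse_imp_weak_drazin_inverse:
  assumes "group_inverse a h"
  shows "weak_drazin_inverse a h"
proof -
  have "k * a * h = k" if "commuting_outer_inverse a k" for k
  proof -
    have k: "k * k * a = k"
      by (simp add: mult.assoc commuting_outer_inverse_rewrites[OF that])
    then have "k * a * h = k * k * a * a * h"
      by simp
    also have "\<dots> = k * k * a"
      by (simp add: mult.assoc group_inverse_rewrites[OF assms])
    finally show ?thesis
      by (simp add: k)
  qed
  with assms show ?thesis
    by (simp add: weak_drazin_inverse_def commuting_outer_inverse_def group_inverse_def)
qed

lemma core_has_group_inverse:
  assumes "commuting_outer_inverse c h"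
  shows "group_inverse (c * c * h) h"
  by (simp add: group_inverse_def mult.assoc commuting_outer_inverse_rewrites[OF assms])

text \<open>The inverse \<open>h\<close> of a group element \<open>a\<close> in its subgroup is a commuting outer inverse, so
  every weak Drazin inverse \<open>k\<close> satisfies \<open>h * a * k = h\<close>; multiplying by \<open>a * a\<close> on
  the left gives the claim.\<close>

lemma core_of_group_element:
  assumes "group_inverse a h" and "weak_drazin_inverse a k"
  shows "a * a * k = a"
proof -
  have "commuting_outer_inverse a h"
    using assms(1) by (simp add: group_inverse_def commuting_outer_inverse_def)
  then have hak: "h * a * k = h"
    using assms(2) by (simp add: weak_drazin_inverse_def)
  have "a * a * k = a * a * (h * a * k)"
    by (simp add: mult.assoc group_inverse_rewrites[OF assms(1)])
  also have "\<dots> = a"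
    unfolding hak by (simp add: mult.assoc group_inverse_rewrites[OF assms(1)])
  finally show ?thesis .
qed

lemma commuting_outer_inverse_swap:
  assumes "commuting_outer_inverse (x * y) h"
  shows "commuting_outer_inverse (y * x) (y * h * h * x)"
  by (simp add: commuting_outer_inverse_def mult.assoc
      commuting_outer_inverse_rewrites[OF assms, simplified mult.assoc])

text \<open>Cline's formula.  To compare with an arbitrary commuting outer inverse \<open>k\<close> of
  \<open>y * x\<close>, carry \<open>k\<close> over to the commuting outer inverse \<open>x * k * k * y\<close> of \<open>x * y\<close>, for which
  \<open>x * y * h\<close> is a right identity, and carry the resulting equation back.\<close>

lemma weak_drazin_inverse_swap:
  assumes "weak_drazin_inverse (x * y) h"
  shows "weak_drazin_inverse (y * x) (y * h * h * x)"
proof -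
  have h: "commuting_outer_inverse (x * y) h"
    using assms by (simp add: weak_drazin_inverse_def)
  note c_simps = mult.assoc commuting_outer_inverse_rewrites[OF h, simplified mult.assoc]
  have "k * (y * x) * (y * h * h * x) = k" if k: "commuting_outer_inverse (y * x) k" for k
  proof -
    note d_simps = mult.assoc commuting_outer_inverse_rewrites[OF k, simplified mult.assoc]
    have "x * k * k * y * (x * y) * h = x * k * k * y"
      using assms commuting_outer_inverse_swap[OF k] by (simp add: weak_drazin_inverse_def)
    then have transported: "x * k * y * h = x * k * k * y"
      by (simp add: d_simps)
    have "k * (y * x) * (y * h * h * x) = k * y * h * x"
      by (simp add: c_simps)
    also have "\<dots> = k * (y * x) * k * y * h * x"
      using k by (simp add: commuting_outer_inverse_def)
    also have "\<dots> = k * y * (x * k * y * h) * x"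
      by (simp add: mult.assoc)
    also have "\<dots> = k"
      unfolding transported by (simp add: d_simps)
    finally show ?thesis .
  qed
  with commuting_outer_inverse_swap[OF h] show ?thesis
    by (simp add: weak_drazin_inverse_def)
qed

text \<open>With the idempotent \<open>p = x * y * h\<close>, the cores of \<open>x * y\<close> and \<open>y * x\<close> are the two products of
  \<open>p * x\<close> and \<open>y * p\<close>.\<close>

lemma cores_primary_conjugate:
  assumes "c \<sim>\<^sub>p d" and "weak_drazin_inverse c h"
  obtains k where "weak_drazin_inverse d k" and "c * c * h \<sim>\<^sub>p d * d * k"
proof -
  from \<open>c \<sim>\<^sub>p d\<close> obtain x y where c: "c = x * y" and d: "d = y * x"
    by (auto simp: primary_conjugate_def)
  have "commuting_outer_inverse c h"
    using assms(2) by (simp add: weak_drazin_inverse_def)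
  note c_simps = mult.assoc commuting_outer_inverse_rewrites[OF this]
  define p k where "p = c * h" and "k = y * h * h * x"
  have pc: "p * c * p = c * c * h"
    by (simp add: p_def c_simps)
  have "c * c * h = (p * x) * (y * p)"
    using pc by (simp add: c mult.assoc)
  moreover have "d * d * k = (y * p) * (p * x)"
  proof -
    have "d * d * k = y * ((x * y) * (x * y) * h * h) * x"
      by (simp add: d k_def mult.assoc)
    also have "(x * y) * (x * y) * h * h = p * p"
      unfolding c[symmetric] by (simp add: p_def c_simps)
    finally show ?thesis
      by (simp add: mult.assoc)
  qed
  ultimately have "c * c * h \<sim>\<^sub>p d * d * k"
    unfolding primary_conjugate_def by (intro exI conjI)
  moreover have "weak_drazin_inverse d k"
    using weak_drazin_inverse_swap assms(2) unfolding c d k_def by blast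
  ultimately show thesis
    using that by blast
qed

lemma cores_primary_conjugate_chain:
  assumes "c \<sim> d" and h: "weak_drazin_inverse c h"
  shows "\<exists>k. weak_drazin_inverse d k \<and> c * c * h \<sim>\<^sub>p d * d * k"
  using assms(1) unfolding conjugate_def
proof (induction rule: tranclp_induct)
  case (base d)
  then show ?case
    using h cores_primary_conjugate by metis
next
  case (step d e)
  then obtain k where k: "weak_drazin_inverse d k" "c * c * h \<sim>\<^sub>p d * d * k"
    by blast
  obtain l where l: "weak_drazin_inverse e l" "d * d * k \<sim>\<^sub>p e * e * l"
    using cores_primary_conjugate[OF step.hyps(2) k(1)] .
  have core: "group_inverse (z * z * m) m" if "weak_drazin_inverse z m" for z m :: 'a
    using that by (simp add: weak_drazin_inverse_def core_has_group_inverse)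
  have "c * c * h \<sim>\<^sub>p e * e * l"
    using primary_conjugate_trans[OF core[OF h] core[OF k(1)] core[OF l(1)] k(2) l(2)] .
  with l(1) show ?case by blast
qed

section \<open>Conjugacy of group elements\<close>

theorem theorem1:
  fixes a b :: "'a::semigroup_mult"
  assumes "group_element a" and "group_element b"
  shows "(a \<sim>\<^sub>p b \<longleftrightarrow>
            (\<exists>u v. mutually_inverse u v \<and> b = u * a * v \<and> a = v * b * u)) \<and>
         (a \<sim> b \<longleftrightarrow> a \<sim>\<^sub>p b)"
proof -
  obtain h where h: "group_inverse a h"
    using assms(1) by (rule group_element_has_group_inverse)
  obtain k where k: "group_inverse b k"
    using assms(2) by (rule group_element_has_group_inverse)
  show ?thesis
  proof (intro conjI iffI)
    assume "a \<sim>\<^sub>p b"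
    then obtain u v where "mutually_inverse u v" "b = u * a * v" "a = v * b * u"
      using primary_conjugate_imp_conjugators[OF h k] by blast
    then show "\<exists>u v. mutually_inverse u v \<and> b = u * a * v \<and> a = v * b * u"
      by (intro exI conjI)
  next
    assume "\<exists>u v. mutually_inverse u v \<and> b = u * a * v \<and> a = v * b * u"
    then show "a \<sim>\<^sub>p b"
      by (elim exE conjE) (rule conjugators_imp_primary_conjugate)
  next
    assume ab: "a \<sim> b"
    have ah: "weak_drazin_inverse a h"
      using h by (rule group_inverse_imp_weak_drazin_inverse)
    obtain l where l: "weak_drazin_inverse b l" "a * a * h \<sim>\<^sub>p b * b * l"
      using cores_primary_conjugate_chain[OF ab ah] by blast
    then show "a \<sim>\<^sub>p b"
      by (simp add: core_of_group_element[OF h ah] core_of_group_element[OF k l(1)])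
  next
    assume "a \<sim>\<^sub>p b"
    then show "a \<sim> b"
      unfolding conjugate_def by (rule tranclp.r_into_trancl)
  qed
qed

end
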